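(* Let $G$ be a group and $k\geq 1$ an integer, and let $F(G,k)=\{(g_1,\ldots,g_k)\in G^k : g_i\neq g_j \text{ for all } i\neq j\}\subset G^k$. (1) If $k=2$, or if $|G|\geq k+1\geq 4$, then $F(G,k)$ is a generating set of the group $G^k$. (2) If $G$ is abelian and finite with $|G|=k\geq 3$, then $F(G,k)$ is not a generating set of $G^k$. *)

theory Defs
  imports "HOL-Algebra.Generated_Groups" "HOL-Algebra.Product_Groups"
begin

definition power_group :: "('a, 'b) monoid_scheme \<Rightarrow> nat \<Rightarrow> (nat \<Rightarrow> 'a) monoid"
  where "power_group G k = product_group {1..k} (\<lambda>_. G)"

definition conf_set :: "('a, 'b) monoid_scheme \<Rightarrow> nat \<Rightarrow> (nat \<Rightarrow> 'a) set"
  where "conf_set G k =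
    {g \<in> carrier (power_group G k). \<forall>i\<in>{1..k}. \<forall>j\<in>{1..k}. i \<noteq> j \<longrightarrow> g i \<noteq> g j}"

definition generating_set :: "('a, 'b) monoid_scheme \<Rightarrow> 'a set \<Rightarrow> bool"
  where "generating_set G S \<longleftrightarrow> S \<subseteq> carrier G \<and> generate G S = carrier G"

text \<open>The order of an infinite group is 0 in HOL-Algebra, so infinite groups,
  which have at least \<open>n\<close> elements for every \<open>n\<close>, are included explicitly.\<close>

definition order_at_least :: "('a, 'b) monoid_scheme \<Rightarrow> nat \<Rightarrow> bool"
  where "order_at_least G n \<longleftrightarrow> infinite (carrier G) \<or> n \<le> order G"

end

theory Submission
  imports Defs "HOL-Algebra.FiniteProduct"
begin

text \<open>
  For the first part, let \<open>h \<noteq> \<one>\<close>. If some configuration has \<open>i\<close>-th entry \<open>\<one>\<close> and avoids \<open>h\<close>, then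
  replacing that entry by \<open>h\<close> gives a second configuration, and the quotient of the two is the
  element of \<open>G\<^sup>k\<close> with \<open>h\<close> in position \<open>i\<close> and \<open>\<one>\<close> elsewhere. Such a configuration exists as soon
  as \<open>G\<close> has \<open>k - 1\<close> elements besides \<open>\<one>\<close> and \<open>h\<close>. For \<open>k = 2\<close> the element itself is a
  configuration.

  For the second part, a configuration enumerates \<open>G\<close>, so the product of its entries is
  \<open>P = (\<Prod>x\<in>G. x)\<close>. Since \<open>P\<^sup>2 = \<one>\<close>, the homomorphism \<open>G\<^sup>k \<rightarrow> G\<close> multiplying all entries maps the
  subgroup generated by the configurations into \<open>{\<one>, P}\<close>, which is not all of \<open>G\<close>.
\<close>

definition single :: "('a, 'b) monoid_scheme \<Rightarrow> nat \<Rightarrow> nat \<Rightarrow> 'a \<Rightarrow> nat \<Rightarrow> 'a"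
  where "single G k i h = (\<lambda>j\<in>{1..k}. if j = i then h else \<one>\<^bsub>G\<^esub>)"

context group
begin

lemma carrier_power_group: "carrier (power_group G k) = {1..k} \<rightarrow>\<^sub>E carrier G"
  by (simp add: power_group_def)

lemma mult_power_group: "x \<otimes>\<^bsub>power_group G k\<^esub> y = (\<lambda>i\<in>{1..k}. x i \<otimes> y i)"
  by (simp add: power_group_def)

lemma one_power_group: "\<one>\<^bsub>power_group G k\<^esub> = (\<lambda>i\<in>{1..k}. \<one>)"
  by (simp add: power_group_def)

lemma group_power_group: "group (power_group G k)"
  by (simp add: power_group_def)

lemma inv_power_group:
  "x \<in> carrier (power_group G k) \<Longrightarrow> inv\<^bsub>power_group G k\<^esub> x = (\<lambda>i\<in>{1..k}. inv (x i))"
  by (simp add: power_group_def)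

lemma conf_set_iff:
  "g \<in> conf_set G k \<longleftrightarrow> g \<in> {1..k} \<rightarrow>\<^sub>E carrier G \<and> inj_on g {1..k}"
  unfolding conf_set_def inj_on_def carrier_power_group by auto

lemma conf_set_subset: "conf_set G k \<subseteq> carrier (power_group G k)"
  by (auto simp: conf_set_def)

lemma single_carrier: "h \<in> carrier G \<Longrightarrow> single G k i h \<in> carrier (power_group G k)"
  by (auto simp: single_def carrier_power_group)

text \<open>Each \<open>x\<close> is the product of the elements \<open>single G k i (x i)\<close>.
  It is built up one coordinate at a time: the truncation of \<open>x\<close> after
  \<open>Suc m\<close> entries is the one after \<open>m\<close> entries times a single
  factor.\<close>

lemma subgroup_power_group_eq_carrier:
  assumes H: "subgroup H (power_group G k)"
    and single: "\<And>i h. i \<in> {1..k} \<Longrightarrow> h \<in> carrier G \<Longrightarrow> single G k i h \<in> H"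
  shows "H = carrier (power_group G k)"
proof
  show "H \<subseteq> carrier (power_group G k)"
    using H by (rule subgroup.subset)
  show "carrier (power_group G k) \<subseteq> H"
  proof
    fix x assume x: "x \<in> carrier (power_group G k)"
    have trunc: "(\<lambda>i\<in>{1..k}. if i \<le> m then x i else \<one>) \<in> H" if "m \<le> k" for m
      using that
    proof (induction m)
      case 0
      have "(\<lambda>i\<in>{1..k}. if i \<le> 0 then x i else \<one>) = \<one>\<^bsub>power_group G k\<^esub>"
        by (auto simp: one_power_group)
      then show ?case using subgroup.one_closed[OF H] by simp
    next
      case (Suc m)
      have xi: "x i \<in> carrier G" if "i \<in> {1..k}" for i
        using x that by (auto simp: carrier_power_group)
      have "(\<lambda>i\<in>{1..k}. if i \<le> Suc m then x i else \<one>) =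
          (\<lambda>i\<in>{1..k}. if i \<le> m then x i else \<one>) \<otimes>\<^bsub>power_group G k\<^esub> single G k (Suc m) (x (Suc m))"
        using xi by (auto simp: mult_power_group single_def fun_eq_iff le_Suc_eq)
      moreover have "\<dots> \<in> H"
        using Suc.prems by (intro subgroup.m_closed[OF H Suc.IH] single xi) simp_all
      ultimately show ?case by simp
    qed
    have "(\<lambda>i\<in>{1..k}. if i \<le> k then x i else \<one>) = x"
      using x by (auto simp: carrier_power_group fun_eq_iff PiE_def extensional_def)
    then show "x \<in> H" using trunc[of k] by simp
  qed
qed

text \<open>For \<open>h = \<one>\<close> the element is the identity of the power group, so only
  nontrivial \<open>h\<close> remain; the constructions below rely on \<open>h\<close> and
  \<open>\<one>\<close> being distinct.\<close>

lemma generating_set_conf_setI: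
  assumes "\<And>i h. i \<in> {1..k} \<Longrightarrow> h \<in> carrier G \<Longrightarrow> h \<noteq> \<one> \<Longrightarrow>
      single G k i h \<in> generate (power_group G k) (conf_set G k)"
  shows "generating_set (power_group G k) (conf_set G k)"
proof -
  have "single G k i \<one> = \<one>\<^bsub>power_group G k\<^esub>" for i
    by (auto simp: single_def one_power_group)
  then have "single G k i h \<in> generate (power_group G k) (conf_set G k)"
    if "i \<in> {1..k}" "h \<in> carrier G" for i h
    using assms[OF that] by (cases "h = \<one>") (simp_all add: generate.one)
  then have "generate (power_group G k) (conf_set G k) = carrier (power_group G k)"
    by (intro subgroup_power_group_eq_carrier
        group.generate_is_subgroup[OF group_power_group conf_set_subset])
  then show ?thesis
    by (simp add: generating_set_def conf_set_subset)
qed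

lemma generating_set_conf_set_two: "generating_set (power_group G 2) (conf_set G 2)"
proof (rule generating_set_conf_setI, rule generate.incl)
  fix i :: nat and h assume "i \<in> {1..2}" "h \<in> carrier G" "h \<noteq> \<one>"
  then show "single G 2 i h \<in> conf_set G 2"
    using single_carrier[of h 2 i]
    by (auto simp: conf_set_iff carrier_power_group single_def inj_on_def split: if_splits)
qed

lemma generating_set_conf_set_large:
  assumes "order_at_least G (k + 1)"
  shows "generating_set (power_group G k) (conf_set G k)"
proof (rule generating_set_conf_setI)
  fix i h assume i: "i \<in> {1..k}" and h: "h \<in> carrier G" "h \<noteq> \<one>"
  let ?P = "power_group G k" and ?C = "carrier G - {\<one>, h}"
  \<comment> \<open>Removing two of at least \<open>k + 1\<close> elements leaves
    \<open>k - 1\<close>, the number of positions other than \<open>i\<close>.\<close>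
  have "infinite ?C \<or> k - 1 \<le> card ?C"
    using assms h by (auto simp: order_at_least_def order_def card_Diff_subset)
  then obtain T where T: "T \<subseteq> ?C" "card T = k - 1" "finite T"
    using infinite_arbitrarily_large[of ?C "k - 1"] obtain_subset_with_card_n[of "k - 1" ?C]
    by auto
  have "card ({1..k} - {i}) = card T"
    using i T by simp
  then obtain f where f: "bij_betw f ({1..k} - {i}) T"
    using T(3) finite_same_card_bij[of "{1..k} - {i}" T] by auto
  \<comment> \<open>The entries off position \<open>i\<close> avoid both \<open>\<one>\<close> and
    \<open>h\<close>, so either value may be put at \<open>i\<close> without a collision.\<close>
  define conf where "conf a = (\<lambda>j\<in>{1..k}. if j = i then a else f j)" for a
  have fj: "f j \<in> carrier G" "f j \<noteq> \<one>" "f j \<noteq> h" if "j \<in> {1..k}" "j \<noteq> i" for j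
    using bij_betwE[OF f] T(1) that by auto
  have conf: "conf a \<in> conf_set G k" if "a = \<one> \<or> a = h" for a
  proof -
    have "inj_on (conf a) {1..k}"
    proof (rule inj_onI)
      fix u v assume uv: "u \<in> {1..k}" "v \<in> {1..k}" "conf a u = conf a v"
      show "u = v"
      proof (cases "u = i \<or> v = i")
        case True
        then show ?thesis
          using uv fj(2,3)[of u] fj(2,3)[of v] that by (simp add: conf_def split: if_splits)
      next
        case False
        then show ?thesis
          using uv inj_onD[OF bij_betw_imp_inj_on[OF f], of u v] by (simp add: conf_def)
      qed
    qed
    then show ?thesis
      using fj h that by (auto simp: conf_set_iff conf_def)
  qed
  \<comment> \<open>Off position \<open>i\<close> the common entries \<open>f j\<close> cancel; at
    \<open>i\<close> what remains is \<open>inv \<one> \<otimes> h = h\<close>.\<close>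
  have "single G k i h = inv\<^bsub>?P\<^esub> (conf \<one>) \<otimes>\<^bsub>?P\<^esub> conf h"
    using conf[of \<one>] conf_set_subset[of k] h fj
    by (auto simp: inv_power_group mult_power_group single_def conf_def fun_eq_iff)
  also have "\<dots> \<in> generate ?P (conf_set G k)"
    using conf by (intro generate.eng generate.inv generate.incl) auto
  finally show "single G k i h \<in> generate ?P (conf_set G k)" .
qed

end

context comm_group
begin

text \<open>Inversion permutes the group, so one factor can be rewritten as the product of all
  inverses; by commutativity each \<open>x\<close> then meets \<open>inv x\<close>. For an infinite
  carrier \<open>finprod\<close> is \<open>\<one>\<close> by default.\<close>

lemma finprod_carrier_square:
  "(\<Otimes>\<^bsub>G\<^esub>x\<in>carrier G. x) \<otimes> (\<Otimes>\<^bsub>G\<^esub>x\<in>carrier G. x) = \<one>"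
proof -
  have "bij_betw (m_inv G) (carrier G) (carrier G)"
    by (rule bij_betw_byWitness[where f' = "m_inv G"]) auto
  then have "(\<Otimes>\<^bsub>G\<^esub>x\<in>carrier G. x) = (\<Otimes>\<^bsub>G\<^esub>x\<in>carrier G. inv x)"
    using finprod_reindex[of "\<lambda>x. x" "m_inv G" "carrier G"] by (auto simp: bij_betw_def)
  then have "(\<Otimes>\<^bsub>G\<^esub>x\<in>carrier G. x) \<otimes> (\<Otimes>\<^bsub>G\<^esub>x\<in>carrier G. x) =
      (\<Otimes>\<^bsub>G\<^esub>x\<in>carrier G. x) \<otimes> (\<Otimes>\<^bsub>G\<^esub>x\<in>carrier G. inv x)"
    by simp
  also have "\<dots> = (\<Otimes>\<^bsub>G\<^esub>x\<in>carrier G. x \<otimes> inv x)"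
    by (rule finprod_multf[symmetric]) auto
  also have "\<dots> = \<one>"
    by (rule finprod_one_eqI) auto
  finally show ?thesis .
qed

text \<open>An injection from \<open>k\<close> indices into a set of \<open>k\<close> elements is
  onto, so \<open>g\<close> merely reindexes the product over the carrier.\<close>

lemma finprod_conf:
  assumes "finite (carrier G)" "order G = k" "g \<in> conf_set G k"
  shows "finprod G g {1..k} = (\<Otimes>\<^bsub>G\<^esub>x\<in>carrier G. x)"
proof -
  have g: "g ` {1..k} \<subseteq> carrier G" "inj_on g {1..k}"
    using assms(3) by (auto simp: conf_set_iff)
  then have "g ` {1..k} = carrier G"
    using assms by (intro card_subset_eq) (auto simp: card_image order_def)
  then show ?thesis
    using finprod_reindex[of "\<lambda>x. x" g "{1..k}"] g by auto
qed

lemma finprod_generate_conf_set: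
  assumes fin: "finite (carrier G)" "order G = k"
    and g: "g \<in> generate (power_group G k) (conf_set G k)"
  shows "finprod G g {1..k} \<in> {\<one>, \<Otimes>\<^bsub>G\<^esub>x\<in>carrier G. x}"
proof -
  let ?P = "power_group G k" and ?p = "\<Otimes>\<^bsub>G\<^esub>x\<in>carrier G. x"
  have p: "?p \<in> carrier G" by (rule finprod_closed) auto
  have mult: "finprod G (x \<otimes>\<^bsub>?P\<^esub> y) {1..k} = finprod G x {1..k} \<otimes> finprod G y {1..k}"
    if "x \<in> carrier ?P" "y \<in> carrier ?P" for x y
  proof -
    have c: "x \<in> {1..k} \<rightarrow> carrier G" "y \<in> {1..k} \<rightarrow> carrier G"
      using that by (auto simp: carrier_power_group)
    have "finprod G (x \<otimes>\<^bsub>?P\<^esub> y) {1..k} = (\<Otimes>\<^bsub>G\<^esub>i\<in>{1..k}. x i \<otimes> y i)"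
      using c by (intro finprod_cong') (auto simp: mult_power_group)
    then show ?thesis using c by (simp add: finprod_multf)
  qed
  have one: "finprod G \<one>\<^bsub>?P\<^esub> {1..k} = \<one>"
    by (rule finprod_one_eqI) (auto simp: one_power_group)
  have carr: "x \<in> carrier ?P" if "x \<in> generate ?P (conf_set G k)" for x
    using group.generate_in_carrier[OF group_power_group conf_set_subset that] .
  show ?thesis using g
  proof (induction rule: generate.induct)
    case one
    then show ?case using \<open>finprod G \<one>\<^bsub>?P\<^esub> {1..k} = \<one>\<close> by simp
  next
    case (incl g)
    then show ?case using finprod_conf[OF fin] by simp
  next
    case (inv g)
    then have g: "g \<in> carrier ?P" using conf_set_subset by auto
    then have ig: "inv\<^bsub>?P\<^esub> g \<in> carrier ?P"
      by (rule group.inv_closed[OF group_power_group])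
    \<comment> \<open>Multiplicativity makes the product of the entries of the inverse configuration
      an inverse of \<open>?p\<close>, and \<open>?p\<close> is its own inverse.\<close>
    have "?p \<otimes> finprod G (inv\<^bsub>?P\<^esub> g) {1..k} = \<one>"
      using mult[OF g ig] one finprod_conf[OF fin inv] group.r_inv[OF group_power_group g] by simp
    moreover have "finprod G (inv\<^bsub>?P\<^esub> g) {1..k} \<in> carrier G"
      using ig by (intro finprod_closed) (auto simp: carrier_power_group)
    ultimately have "finprod G (inv\<^bsub>?P\<^esub> g) {1..k} = ?p"
      using finprod_carrier_square p
      by (metis inv_equality m_comm)
    then show ?case by simp
  next
    case (eng x y)
    then show ?case
      using mult[OF carr[OF eng(1)] carr[OF eng(2)]] finprod_carrier_square p by auto
  qed
qed

lemma not_generating_set_conf_set: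
  assumes fin: "finite (carrier G)" "order G = k" and k: "k \<ge> 3"
  shows "\<not> generating_set (power_group G k) (conf_set G k)"
proof
  assume gen: "generating_set (power_group G k) (conf_set G k)"
  let ?p = "\<Otimes>\<^bsub>G\<^esub>x\<in>carrier G. x"
  \<comment> \<open>At most two values against at least three group elements: some \<open>h\<close>
    is missed.\<close>
  have "card {\<one>, ?p} < card (carrier G)"
    using fin(2) k card_insert_le_m1[of 2 "{?p}" \<one>] by (simp add: order_def)
  then have "\<not> carrier G \<subseteq> {\<one>, ?p}"
    using card_mono[of "{\<one>, ?p}" "carrier G"] by (meson finite.intros leD)
  then obtain h where h: "h \<in> carrier G" "h \<notin> {\<one>, ?p}" by auto
  \<comment> \<open>The product of the entries of \<open>single G k 1 h\<close> is \<open>h\<close>,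
    so this element lies outside the generated subgroup. The test is turned into
    \<open>1 = j\<close> to fit \<open>finprod_singleton\<close>.\<close>
  have "finprod G (single G k 1 h) {1..k} = (\<Otimes>\<^bsub>G\<^esub>j\<in>{1..k}. if 1 = j then h else \<one>)"
    using h by (intro finprod_cong') (auto simp: single_def)
  also have "\<dots> = h"
    using k h finprod_singleton[of 1 "{1..k}" "\<lambda>_. h"] by simp
  finally show False
    using finprod_generate_conf_set[OF fin, of "single G k 1 h"] gen h single_carrier[of h k 1]
    by (simp add: generating_set_def)
qed

end

theorem theorem2p8:
  fixes G :: "('a, 'b) monoid_scheme" and k :: nat
  assumes "group G" and "k \<ge> 1"
  shows "(k = 2 \<or> (order_at_least G (k + 1) \<and> k + 1 \<ge> 4)
            \<longrightarrow> generating_set (power_group G k) (conf_set G k))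
       \<and> (comm_group G \<and> finite (carrier G) \<and> order G = k \<and> k \<ge> 3
            \<longrightarrow> \<not> generating_set (power_group G k) (conf_set G k))"
  using group.generating_set_conf_set_two[OF assms(1)]
    group.generating_set_conf_set_large[OF assms(1)]
    comm_group.not_generating_set_conf_set
  by blast

end
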